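(* Let $n \geq 2$ and $d \geq 2$ be integers, and suppose the number of players satisfies $k \geq 4^{2^{\lceil \log d \rceil}} \log n$. Then for every composed function $f \circ \vec{g}$ with $f : \{0,1\}^n \to \{0,1\}$ symmetric and $\vec{g} = (g_1,\dots,g_n)$ where each $g_j : \mathbb{Z}_d^k \to \{0,1\}$ is symmetric (the $g_j$ may differ from one another), there exists a deterministic simultaneous Number-On-the-Forehead protocol for $k$ players that computes $f \circ \vec{g}$ with cost at most $4^{2^{\lceil \log d \rceil + 2}} \log^{2 \cdot 2^{\lceil \log d \rceil}}(n)$.
   Context: Logarithms are base 2. $\mathbb{Z}_d = \{0,\dots,d-1\}$. A function is symmetric if it is invariant under every permutation of its input variables. Composed function: for inputs $x_1,\dots,x_k \in \mathbb{Z}_d^n$, form the $k \times n$ matrix $M$ whose row $i$ is $x_i$, and let $C_j \in \mathbb{Z}_d^k$ be its $j$-th column; then $f \circ \vec{g}(x_1,\dots,x_k) = f(g_1(C_1),\dots,g_n(C_n))$. Deterministic simultaneous Number-On-the-Forehead (NOF) model: there are $k$ players; player $i$ sees all inputs except $x_i$. Each player, without any communication with the other players, sends a message (a bit string depending deterministically on what she sees) to a referee, who does not see any of the input; the referee must then determine the function value from the messages alone. The cost is the worst-case (over inputs) total number of bits sent to the referee. *)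

theory Defs
  imports Complex_Main "HOL-Library.FuncSet" "HOL-Combinatorics.Permutations"
begin

text \<open>Vectors in \<open>A\<^sup>m\<close> are the extensional functions in \<open>{..<m} \<rightarrow>\<^sub>E A\<close>, with coordinates
  numbered from \<open>0\<close>; \<open>\<int>\<^sub>d\<close> is the set \<open>{..<d}\<close> of natural numbers, and \<open>{0,1}\<close> is \<^typ>\<open>bool\<close>.\<close>

definition symmetric_on :: "nat \<Rightarrow> 'a set \<Rightarrow> ((nat \<Rightarrow> 'a) \<Rightarrow> 'b) \<Rightarrow> bool" where
  "symmetric_on m A h \<longleftrightarrow>
     (\<forall>x \<in> {..<m} \<rightarrow>\<^sub>E A. \<forall>\<pi>. \<pi> permutes {..<m} \<longrightarrow> h (x \<circ> \<pi>) = h x)"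

definition column :: "nat \<Rightarrow> (nat \<Rightarrow> nat \<Rightarrow> 'a) \<Rightarrow> nat \<Rightarrow> (nat \<Rightarrow> 'a)" where
  "column k X j = (\<lambda>i\<in>{..<k}. X i j)"

definition composed ::
  "nat \<Rightarrow> nat \<Rightarrow> ((nat \<Rightarrow> bool) \<Rightarrow> bool) \<Rightarrow> (nat \<Rightarrow> (nat \<Rightarrow> 'a) \<Rightarrow> bool)
    \<Rightarrow> (nat \<Rightarrow> nat \<Rightarrow> 'a) \<Rightarrow> bool" where
  "composed k n f g X = f (\<lambda>j\<in>{..<n}. g j (column k X j))"

text \<open>A deterministic simultaneous protocol: a message function for each player, applied only to
  that player's view, and a referee reading the list of all messages.\<close>

record ('x, 'r) nof_protocol =
  message :: "nat \<Rightarrow> (nat \<Rightarrow> 'x) \<Rightarrow> bool list"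
  referee :: "bool list list \<Rightarrow> 'r"

definition nof_inputs :: "nat \<Rightarrow> 'x set \<Rightarrow> (nat \<Rightarrow> 'x) set" where
  "nof_inputs k A = {..<k} \<rightarrow>\<^sub>E A"

definition nof_view :: "nat \<Rightarrow> nat \<Rightarrow> (nat \<Rightarrow> 'x) \<Rightarrow> (nat \<Rightarrow> 'x)" where
  "nof_view k i X = restrict X ({..<k} - {i})"

definition nof_transcript :: "nat \<Rightarrow> ('x, 'r) nof_protocol \<Rightarrow> (nat \<Rightarrow> 'x) \<Rightarrow> bool list list" where
  "nof_transcript k P X = map (\<lambda>i. message P i (nof_view k i X)) [0..<k]"

definition nof_computes ::
  "nat \<Rightarrow> 'x set \<Rightarrow> ('x, 'r) nof_protocol \<Rightarrow> ((nat \<Rightarrow> 'x) \<Rightarrow> 'r) \<Rightarrow> bool" where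
  "nof_computes k A P F \<longleftrightarrow>
     (\<forall>X \<in> nof_inputs k A. referee P (nof_transcript k P X) = F X)"

text \<open>The maximum is meaningful for finite nonempty \<open>A\<close>, where the set of inputs is finite and
  nonempty.\<close>

definition nof_cost :: "nat \<Rightarrow> 'x set \<Rightarrow> ('x, 'r) nof_protocol \<Rightarrow> nat" where
  "nof_cost k A P =
     Max ((\<lambda>X. sum_list (map length (nof_transcript k P X))) ` nof_inputs k A)"

end

theory Submission
  imports Defs
begin

text \<open>Process the players \<open>0, 1, 2, \<dots>\<close> in turn and keep a shrinking set of columns whose
  contribution is still to be accounted for. Player \<open>i\<close> knows this set, as it depends on the rows
  before \<open>i\<close> only. Let \<open>a\<close> be the most popular letter of row \<open>i\<close> on it. Replacing entry \<open>i\<close> of each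
  column by \<open>a\<close> changes nothing for the columns that carry \<open>a\<close> there, and turns the current sum into
  one that player \<open>i\<close> can evaluate; the error lives on the remaining columns, a fraction of at most
  \<open>1 - 1/d\<close>, and becomes the next sum. Player \<open>i\<close> cannot know \<open>a\<close>, so she sends her value for every
  letter, while player \<open>i + 1\<close> sends \<open>a\<close>. After about \<open>d ln n\<close> players no column is left, and adding
  up modulo a power of two exceeding \<open>n\<close> gives the number of ones in the input of \<open>f\<close>.\<close>

section \<open>Popular letters, surviving columns and residuals\<close>

definition popular :: "nat \<Rightarrow> nat set \<Rightarrow> (nat \<Rightarrow> nat) \<Rightarrow> nat" where
  "popular d B x = (SOME a. a < d \<and> card B \<le> d * card {j \<in> B. x j = a})"

primrec unmatched :: "nat \<Rightarrow> nat \<Rightarrow> (nat \<Rightarrow> nat \<Rightarrow> nat) \<Rightarrow> nat \<Rightarrow> nat set" where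
  "unmatched d n X 0 = {..<n}"
| "unmatched d n X (Suc i) =
    {j \<in> unmatched d n X i. X i j \<noteq> popular d (unmatched d n X i) (X i)}"

definition letter :: "nat \<Rightarrow> nat \<Rightarrow> (nat \<Rightarrow> nat \<Rightarrow> nat) \<Rightarrow> nat \<Rightarrow> nat" where
  "letter d n X i = popular d (unmatched d n X i) (X i)"

text \<open>An iterated finite difference: unfolded, it is the sum of \<open>h\<close> over all ways
  to overwrite some entries of \<open>c\<close> below \<open>i\<close> by those of \<open>y\<close>,
  with a factor \<open>-1\<close> for each overwritten entry. Hence the integer values.\<close>

primrec residual :: "((nat \<Rightarrow> 'a) \<Rightarrow> bool) \<Rightarrow> (nat \<Rightarrow> 'a) \<Rightarrow> nat \<Rightarrow> (nat \<Rightarrow> 'a) \<Rightarrow> int" where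
  "residual h y 0 c = of_bool (h c)"
| "residual h y (Suc i) c = residual h y i c - residual h y i (c(i := y i))"

definition contribution ::
  "nat \<Rightarrow> nat \<Rightarrow> nat \<Rightarrow> (nat \<Rightarrow> (nat \<Rightarrow> nat) \<Rightarrow> bool) \<Rightarrow> (nat \<Rightarrow> nat \<Rightarrow> nat) \<Rightarrow> nat \<Rightarrow> nat \<Rightarrow> int" where
  "contribution d n k g X i a =
    (\<Sum>j\<in>unmatched d n X i. residual (g j) (letter d n X) i ((column k X j)(i := a)))"

text \<open>Pigeonhole: were every letter class smaller than \<open>card B / d\<close>, the
  \<open>d\<close> classes partitioning \<open>B\<close> could not add up to
  \<open>card B\<close>.\<close>

lemma popular:
  assumes "finite B" "x ` B \<subseteq> {..<d}" "d > 0"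
  shows "popular d B x < d \<and> card B \<le> d * card {j \<in> B. x j = popular d B x}"
proof -
  have "\<exists>a<d. card B \<le> d * card {j \<in> B. x j = a}"
  proof (rule ccontr)
    assume "\<not> ?thesis"
    then have less: "d * card {j \<in> B. x j = a} < card B" if "a < d" for a
      using that by (meson not_le)
    have "B = (\<Union>a\<in>{..<d}. {j \<in> B. x j = a})"
      using assms(2) by auto
    moreover have "card (\<Union>a\<in>{..<d}. {j \<in> B. x j = a}) = (\<Sum>a<d. card {j \<in> B. x j = a})"
      by (intro card_UN_disjoint) (use assms(1) in auto)
    ultimately have "d * card B = (\<Sum>a<d. d * card {j \<in> B. x j = a})"
      by (simp add: sum_distrib_left)
    also have "\<dots> < (\<Sum>a<d. card B)"
      by (rule sum_strict_mono) (use less assms(3) in auto)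
    finally show False by simp
  qed
  then show ?thesis
    unfolding popular_def by (rule someI_ex)
qed

lemma unmatched_subset: "unmatched d n X i \<subseteq> {..<n}"
  by (induction i) auto

lemma finite_unmatched [simp]: "finite (unmatched d n X i)"
  by (rule finite_subset[OF unmatched_subset]) simp

lemma unmatched_cong:
  "(\<And>i'. i' < i \<Longrightarrow> X i' = Y i') \<Longrightarrow> unmatched d n X i = unmatched d n Y i"
  by (induction i) auto

lemma letter_cong:
  "(\<And>i'. i' \<le> i \<Longrightarrow> X i' = Y i') \<Longrightarrow> letter d n X i = letter d n Y i"
  using unmatched_cong[of i X Y] by (simp add: letter_def)

lemma residual_cong:
  "(\<And>i'. i' < i \<Longrightarrow> y i' = y' i') \<Longrightarrow> residual h y i c = residual h y' i c"
  by (induction i arbitrary: c) auto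

text \<open>Entry \<open>i\<close> of each column is overwritten by \<open>a\<close>, and the
  surviving set and the letters in the residual consult only rows before \<open>i\<close>. So player
  \<open>i\<close> can evaluate this from her own view.\<close>

lemma contribution_cong:
  assumes "\<And>i'. i' < k \<Longrightarrow> i' \<noteq> i \<Longrightarrow> X i' = Y i'" "i < k"
  shows "contribution d n k g X i a = contribution d n k g Y i a"
proof -
  have "unmatched d n X i = unmatched d n Y i"
    by (rule unmatched_cong) (use assms in auto)
  moreover have "(column k X j)(i := a) = (column k Y j)(i := a)" for j
    using assms by (auto simp: column_def)
  moreover have "residual (g j) (letter d n X) i c = residual (g j) (letter d n Y) i c" for j c
    by (intro residual_cong letter_cong) (use assms in auto)
  ultimately show ?thesis
    by (simp add: contribution_def)
qed

text \<open>Telescoping: each residual is its value at the overwritten column, collected in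
  \<open>contribution\<close>, plus the next residual. The latter vanishes on the columns leaving
  the set, whose entry already is the letter.\<close>

lemma sum_residual_unmatched:
  "(\<Sum>j<n. of_bool (g j (column k X j))) =
    (\<Sum>i<r. contribution d n k g X i (letter d n X i)) +
    (\<Sum>j\<in>unmatched d n X r. residual (g j) (letter d n X) r (column k X j))" if "r \<le> k"
  using that
proof (induction r)
  case (Suc r)
  let ?y = "letter d n X" and ?c = "column k X"
  have "(\<Sum>j\<in>unmatched d n X r. residual (g j) ?y (Suc r) (?c j)) =
        (\<Sum>j\<in>unmatched d n X (Suc r). residual (g j) ?y (Suc r) (?c j))"
  proof (rule sum.mono_neutral_right)
    show "\<forall>j\<in>unmatched d n X r - unmatched d n X (Suc r). residual (g j) ?y (Suc r) (?c j) = 0"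
    proof
      fix j assume "j \<in> unmatched d n X r - unmatched d n X (Suc r)"
      then have "?c j r = ?y r"
        using Suc.prems by (simp add: letter_def column_def)
      then have "(?c j)(r := ?y r) = ?c j"
        by (metis fun_upd_triv)
      then show "residual (g j) ?y (Suc r) (?c j) = 0"
        by simp
    qed
  qed auto
  then show ?case
    using Suc by (simp add: contribution_def sum_subtractf)
qed simp

section \<open>Decay of the surviving columns\<close>

lemma card_unmatched_Suc:
  assumes "X \<in> nof_inputs k ({..<n} \<rightarrow>\<^sub>E {..<d})" "d > 0" "i < k"
  shows "d * card (unmatched d n X (Suc i)) \<le> (d - 1) * card (unmatched d n X i)"
proof -
  let ?B = "unmatched d n X i"
  let ?M = "{j \<in> ?B. X i j = popular d ?B (X i)}"
  have "X i ` ?B \<subseteq> {..<d}"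
    using assms unmatched_subset[of d n X i] by (fastforce simp: nof_inputs_def PiE_iff)
  from popular[OF _ this] have "card ?B \<le> d * card ?M"
    using assms by simp
  moreover have "unmatched d n X (Suc i) = ?B - ?M"
    by auto
  then have "card (unmatched d n X (Suc i)) = card ?B - card ?M"
    by (simp add: card_Diff_subset)
  ultimately show ?thesis
    by (simp add: diff_mult_distrib diff_mult_distrib2)
qed

lemma card_unmatched:
  assumes "X \<in> nof_inputs k ({..<n} \<rightarrow>\<^sub>E {..<d})" "d > 0" "i \<le> k"
  shows "d ^ i * card (unmatched d n X i) \<le> (d - 1) ^ i * n"
  using assms(3)
proof (induction i)
  case (Suc i)
  have "d ^ Suc i * card (unmatched d n X (Suc i)) = d ^ i * (d * card (unmatched d n X (Suc i)))"
    by simp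
  also have "\<dots> \<le> d ^ i * ((d - 1) * card (unmatched d n X i))"
    using card_unmatched_Suc[OF assms(1,2), of i] Suc.prems by (intro mult_left_mono) auto
  also have "\<dots> = (d - 1) * (d ^ i * card (unmatched d n X i))"
    by simp
  also have "\<dots> \<le> (d - 1) * ((d - 1) ^ i * n)"
    using Suc by (intro mult_left_mono) auto
  finally show ?case by (simp add: mult.assoc)
qed simp

text \<open>For \<open>d >= 2\<close>, Bernoulli gives
  \<open>(1 + 1/(d-1)) ^ d >= 1 + d/(d-1) >= 2\<close>. Thus \<open>d\<close> rounds halve the bound
  on the surviving columns.\<close>

lemma two_mult_power_pred_le: "2 * (d - 1) ^ d \<le> (d::nat) ^ d" if "d > 0"
proof (cases "d = 1")
  case False
  define x where "x = real (d - 1)"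
  have x: "x > 0" "real d = x + 1"
    using False that by (auto simp: x_def of_nat_diff)
  have "2 \<le> 1 + real d * (1 / x)"
    using x by (simp add: field_simps)
  also have "\<dots> \<le> (1 + 1 / x) ^ d"
    using x by (intro Bernoulli_inequality) (simp add: order_trans[of _ 0])
  also have "1 + 1 / x = real d / x"
    using x by (simp add: field_simps)
  finally have "2 * x ^ d \<le> real d ^ d"
    using x by (simp add: power_divide field_simps)
  then have "real (2 * (d - 1) ^ d) \<le> real (d ^ d)"
    by (simp add: x_def)
  then show ?thesis
    by linarith
qed simp

text \<open>After \<open>b\<close> halvings the bound \<open>n\<close> drops below one, and a
  cardinality below one is zero.\<close>

lemma unmatched_empty:
  assumes "X \<in> nof_inputs k ({..<n} \<rightarrow>\<^sub>E {..<d})" "d \<ge> 2" "d * b \<le> k" "n < 2 ^ b"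
  shows "unmatched d n X (d * b) = {}"
proof -
  let ?U = "card (unmatched d n X (d * b))"
  have "(2 * (d - 1) ^ d) ^ b \<le> (d ^ d) ^ b"
    using two_mult_power_pred_le[of d] assms(2) by (intro power_mono) auto
  then have "2 ^ b * (d - 1) ^ (d * b) \<le> d ^ (d * b)"
    by (simp add: power_mult power_mult_distrib)
  then have "2 ^ b * (d - 1) ^ (d * b) * ?U \<le> d ^ (d * b) * ?U"
    by (rule mult_right_mono) simp
  also have "\<dots> \<le> (d - 1) ^ (d * b) * n"
    using card_unmatched[OF assms(1), of "d * b"] assms(2,3) by simp
  finally have "(d - 1) ^ (d * b) * (2 ^ b * ?U) \<le> (d - 1) ^ (d * b) * n"
    by (simp add: mult_ac)
  then have "2 ^ b * ?U \<le> n"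
    using assms(2) by simp
  then have "?U = 0"
    using assms(4) by (cases ?U) auto
  then show ?thesis
    by simp
qed

section \<open>Symmetric functions on bits and fixed-length codes\<close>

text \<open>A bijection between the ones and one between the zeros glue to a permutation with
  \<open>z \<circ> \<pi> = z'\<close>.\<close>

lemma symmetric_on_bool_eq:
  assumes "symmetric_on n (UNIV :: bool set) f"
    and z: "z \<in> {..<n} \<rightarrow>\<^sub>E UNIV" "z' \<in> {..<n} \<rightarrow>\<^sub>E UNIV"
    and card: "card {j\<in>{..<n}. z j} = card {j\<in>{..<n}. z' j}"
  shows "f z = f z'"
proof -
  let ?A = "{j\<in>{..<n}. z j}" and ?A' = "{j\<in>{..<n}. z' j}"
  obtain p where p: "bij_betw p ?A' ?A"
    using finite_same_card_bij[of ?A' ?A] card by auto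
  have "card ({..<n} - ?A') = card ({..<n} - ?A)"
    using card by (subst (1 2) card_Diff_subset) auto
  then obtain q where q: "bij_betw q ({..<n} - ?A') ({..<n} - ?A)"
    using finite_same_card_bij[of "{..<n} - ?A'" "{..<n} - ?A"] by auto
  define \<pi> where "\<pi> j = (if j \<in> ?A' then p j else if j < n then q j else j)" for j
  have "bij_betw \<pi> ?A' ?A"
    using p by (rule bij_betw_cong[THEN iffD1, rotated]) (simp add: \<pi>_def)
  moreover have "bij_betw \<pi> ({..<n} - ?A') ({..<n} - ?A)"
    using q by (rule bij_betw_cong[THEN iffD1, rotated]) (auto simp: \<pi>_def)
  ultimately have "bij_betw \<pi> (?A' \<union> ({..<n} - ?A')) (?A \<union> ({..<n} - ?A))"
    by (rule bij_betw_combine) auto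
  moreover have "?A' \<union> ({..<n} - ?A') = {..<n}" "?A \<union> ({..<n} - ?A) = {..<n}"
    by auto
  ultimately have "bij_betw \<pi> {..<n} {..<n}"
    by (simp only:)
  then have \<pi>: "\<pi> permutes {..<n}"
    by (rule bij_imp_permutes) (auto simp: \<pi>_def)
  have "(z \<circ> \<pi>) j = z' j" for j
  proof (cases "j < n")
    case True
    then show ?thesis
      using bij_betwE[OF p] bij_betwE[OF q] by (cases "z' j") (auto simp: \<pi>_def)
  next
    case False
    \<comment> \<open>Outside the coordinates both vectors are \<open>undefined\<close> by
      extensionality.\<close>
    then show ?thesis
      using z by (auto simp: \<pi>_def PiE_iff extensional_def)
  qed
  then have "z \<circ> \<pi> = z'" by auto
  then show ?thesis
    using assms(1) z(1) \<pi> unfolding symmetric_on_def by metis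
qed

text \<open>Both sets have \<open>2 ^ (m * b)\<close> elements. Only invertibility and the fixed
  length matter, so counting replaces an explicit binary code.\<close>

lemma ex_nat_list_encoding:
  "\<exists>enc :: nat list \<Rightarrow> bool list. bij_betw enc {xs. set xs \<subseteq> {..<2 ^ b} \<and> length xs = m}
      {ys. length ys = m * b}"
proof (rule finite_same_card_bij)
  show "finite {xs. set xs \<subseteq> {..<2 ^ b :: nat} \<and> length xs = m}"
    by (rule finite_lists_length_eq) simp
  show "finite {ys :: bool list. length ys = m * b}"
    using finite_lists_length_eq[of "UNIV :: bool set" "m * b"] by simp
  show "card {xs. set xs \<subseteq> {..<2 ^ b :: nat} \<and> length xs = m} =
        card {ys :: bool list. length ys = m * b}"
    using card_lists_length_eq[of "{..<2 ^ b :: nat}" m]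
      card_lists_length_eq[of "UNIV :: bool set" "m * b"]
    by (simp add: power_mult[symmetric] mult.commute)
qed

lemma nof_cost_le:
  assumes "finite A" "A \<noteq> {}"
    and "\<And>X. X \<in> nof_inputs k A \<Longrightarrow> sum_list (map length (nof_transcript k P X)) \<le> c"
  shows "nof_cost k A P \<le> c"
  unfolding nof_cost_def using assms
  by (subst Max_le_iff) (auto simp: nof_inputs_def PiE_eq_empty_iff intro!: finite_PiE)

section \<open>The protocol, its correctness and its cost\<close>

lemma ex_nof_protocol_symmetric_composed:
  fixes f :: "(nat \<Rightarrow> bool) \<Rightarrow> bool" and g :: "nat \<Rightarrow> (nat \<Rightarrow> nat) \<Rightarrow> bool"
  assumes d: "d \<ge> 2" and b: "n < 2 ^ b" "d \<le> 2 ^ b" and k: "d * b < k"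
    and f: "symmetric_on n UNIV f"
  shows "\<exists>P. nof_computes k ({..<n} \<rightarrow>\<^sub>E {..<d}) P (composed k n f g) \<and>
    nof_cost k ({..<n} \<rightarrow>\<^sub>E {..<d}) P \<le> (d * b + 1) * ((d + 1) * b)"
proof -
  define R where "R = d * b"
  let ?L = "{xs. set xs \<subseteq> {..<2 ^ b :: nat} \<and> length xs = d + 1}"
  obtain enc :: "nat list \<Rightarrow> bool list"
    where enc: "bij_betw enc ?L {ys. length ys = (d + 1) * b}"
    using ex_nat_list_encoding by blast
  define dec where "dec = inv_into ?L enc"
  \<comment> \<open>One residue per candidate letter, then the letter of the preceding row. For
    player \<open>0\<close> the truncated \<open>i - 1\<close> is \<open>0\<close>, her own hidden
    row; \<open>mod 2 ^ b\<close> keeps even that entry in the alphabet, and the referee takes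
    letters from player \<open>1\<close> on.\<close>
  define info where "info i X = map (\<lambda>a. nat (contribution d n k g X i a mod 2 ^ b)) [0..<d]
      @ [letter d n X (i - 1) mod 2 ^ b]" for i X
  \<comment> \<open>Players \<open>0\<close> to \<open>R\<close> speak: the last one supplies the
    letter of row \<open>R - 1\<close>, whence \<open>d * b < k\<close>. The referee feeds
    \<open>f\<close> a vector of leading ones, as many as the recovered count.\<close>
  define P where "P = \<lparr>
    message = (\<lambda>i V. if i \<le> R then enc (info i V) else []),
    referee = (\<lambda>t. f (\<lambda>j\<in>{..<n}.
      int j < (\<Sum>i<R. int (dec (t ! i) ! (dec (t ! Suc i) ! d))) mod 2 ^ b))\<rparr>"
  have info_mem: "info i V \<in> ?L" for i V
  proof -
    have "nat (z mod 2 ^ b) < 2 ^ b" for z :: int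
      by (simp add: nat_less_iff)
    then show ?thesis by (auto simp: info_def)
  qed
  have length_enc: "length (enc (info i V)) = (d + 1) * b" for i V
    using bij_betwE[OF enc] info_mem by blast
  have dec_enc: "dec (enc (info i V)) = info i V" for i V
    unfolding dec_def using bij_betw_inv_into_left[OF enc info_mem] .
  have "nof_computes k ({..<n} \<rightarrow>\<^sub>E {..<d}) P (composed k n f g)"
    unfolding nof_computes_def
  proof
    fix X assume X: "X \<in> nof_inputs k ({..<n} \<rightarrow>\<^sub>E {..<d})"
    let ?t = "nof_transcript k P X"
    let ?N = "card {j\<in>{..<n}. g j (column k X j)}"
    have le: "?N \<le> n"
      using card_mono[of "{..<n}" "{j\<in>{..<n}. g j (column k X j)}"] by auto
    have t: "dec (?t ! i) = info i (nof_view k i X)" if "i \<le> R" for i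
      using that k dec_enc by (simp add: nof_transcript_def P_def R_def)
    have letter_less: "letter d n X i < d" if "i < k" for i
    proof -
      have "X i ` unmatched d n X i \<subseteq> {..<d}"
        using X that unmatched_subset[of d n X i] by (fastforce simp: nof_inputs_def PiE_iff)
      from popular[OF _ this] show ?thesis
        using d by (simp add: letter_def)
    qed
    have "int (dec (?t ! i) ! (dec (?t ! Suc i) ! d)) =
        contribution d n k g X i (letter d n X i) mod 2 ^ b" if i: "i < R" for i
    proof -
      \<comment> \<open>The letter of row \<open>i\<close> depends on rows up to \<open>i\<close>
        only, all visible to player \<open>Suc i\<close>.\<close>
      have "letter d n (nof_view k (Suc i) X) i = letter d n X i"
        by (rule letter_cong) (use i k in \<open>auto simp: nof_view_def R_def\<close>)
      moreover have less: "letter d n X i < d"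
        using letter_less i k by (simp add: R_def)
      ultimately have "dec (?t ! Suc i) ! d = letter d n X i"
        using t[of "Suc i"] i b by (simp add: info_def nth_append)
      moreover have "contribution d n k g (nof_view k i X) i a = contribution d n k g X i a" for a
        by (rule contribution_cong) (use i k in \<open>auto simp: nof_view_def R_def\<close>)
      ultimately show ?thesis
        using t[of i] i less by (simp add: info_def nth_append)
    qed
    then have "(\<Sum>i<R. int (dec (?t ! i) ! (dec (?t ! Suc i) ! d))) mod 2 ^ b =
        (\<Sum>i<R. contribution d n k g X i (letter d n X i)) mod 2 ^ b"
      by (simp add: mod_sum_eq)
    \<comment> \<open>No column survives \<open>R\<close> rounds, so the remaining residual sum is
      empty.\<close>
    also have "(\<Sum>i<R. contribution d n k g X i (letter d n X i)) =
        (\<Sum>j<n. of_bool (g j (column k X j)))"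
      using sum_residual_unmatched[of R k g X n d] unmatched_empty[OF X d _ b(1)] k
      by (simp add: R_def)
    also have "\<dots> = int ?N"
      by (subst sum_of_bool_eq) (auto intro: arg_cong[where f = card])
    \<comment> \<open>Contributions may be negative or large, but residues suffice: the count they
      add up to is below \<open>2 ^ b\<close>.\<close>
    also have "int ?N mod 2 ^ b = int ?N"
      using le b(1) by (metis le_less_trans mod_less of_nat_mod of_nat_numeral of_nat_power)
    finally have "referee P ?t = f (\<lambda>j\<in>{..<n}. j < ?N)"
      by (simp add: P_def)
    also have "\<dots> = f (\<lambda>j\<in>{..<n}. g j (column k X j))"
    proof (rule symmetric_on_bool_eq[OF f])
      have "{j\<in>{..<n}. (\<lambda>j\<in>{..<n}. j < ?N) j} = {..<?N}"
        using le by auto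
      moreover have "{j\<in>{..<n}. (\<lambda>j\<in>{..<n}. g j (column k X j)) j} =
          {j\<in>{..<n}. g j (column k X j)}"
        by auto
      ultimately show "card {j\<in>{..<n}. (\<lambda>j\<in>{..<n}. j < ?N) j} =
          card {j\<in>{..<n}. (\<lambda>j\<in>{..<n}. g j (column k X j)) j}"
        by simp
    qed auto
    finally show "referee P ?t = composed k n f g X"
      by (simp add: composed_def)
  qed
  moreover have "nof_cost k ({..<n} \<rightarrow>\<^sub>E {..<d}) P \<le> (R + 1) * ((d + 1) * b)"
  proof (rule nof_cost_le)
    fix X
    have "sum_list (map length (nof_transcript k P X)) =
        (\<Sum>i<k. if i \<le> R then (d + 1) * b else 0)"
      by (auto simp: nof_transcript_def P_def length_enc interv_sum_list_conv_sum_set_nat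
          atLeast0LessThan intro!: sum.cong)
    also have "\<dots> = card ({..<k} \<inter> {..R}) * ((d + 1) * b)"
      by (simp add: sum.If_cases atMost_def)
    also have "{..<k} \<inter> {..R} = {..R}"
      using k by (auto simp: R_def)
    finally show "sum_list (map length (nof_transcript k P X)) \<le> (R + 1) * ((d + 1) * b)"
      by simp
  qed (use d in \<open>auto simp: PiE_eq_empty_iff lessThan_empty_iff intro!: finite_PiE\<close>)
  ultimately show ?thesis
    unfolding R_def by blast
qed

section \<open>Choice of the word length and numerical bounds\<close>

theorem theorem12:
  fixes n d k :: nat
    and f :: "(nat \<Rightarrow> bool) \<Rightarrow> bool"
    and g :: "nat \<Rightarrow> (nat \<Rightarrow> nat) \<Rightarrow> bool"
  assumes "n \<ge> 2" and "d \<ge> 2"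
    and "real k \<ge> 4 ^ (2 ^ nat \<lceil>log 2 (real d)\<rceil>) * log 2 (real n)"
    and "symmetric_on n (UNIV :: bool set) f"
    and "\<And>j. j < n \<Longrightarrow> symmetric_on k {..<d} (g j)"
  shows "\<exists>P :: (nat \<Rightarrow> nat, bool) nof_protocol.
    nof_computes k ({..<n} \<rightarrow>\<^sub>E {..<d}) P (composed k n f g) \<and>
    real (nof_cost k ({..<n} \<rightarrow>\<^sub>E {..<d}) P)
      \<le> 4 ^ (2 ^ (nat \<lceil>log 2 (real d)\<rceil> + 2)) * log 2 (real n) ^ (2 * 2 ^ nat \<lceil>log 2 (real d)\<rceil>)"
proof -
  define D :: nat where "D = 2 ^ nat \<lceil>log 2 (real d)\<rceil>"
  define L where "L = log 2 (real n)"
  \<comment> \<open>Taking \<open>n + d\<close> secures both \<open>n < 2 ^ b\<close>, for the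
    count, and \<open>d <= 2 ^ b\<close>, for sending a letter.\<close>
  define b where "b = nat \<lceil>log 2 (real (n + d))\<rceil>"
  have L: "L \<ge> 1"
    using assms(1) by (simp add: L_def)
  have le_pow: "m \<le> 2 ^ nat \<lceil>log 2 (real m)\<rceil>" if "m \<ge> 2" for m :: nat
  proof -
    have "real m = 2 powr log 2 (real m)"
      using that by simp
    also have "\<dots> \<le> 2 powr real (nat \<lceil>log 2 (real m)\<rceil>)"
      by (intro powr_mono) linarith+
    also have "\<dots> = real (2 ^ nat \<lceil>log 2 (real m)\<rceil>)"
      by (simp add: powr_realpow)
    finally show ?thesis
      by linarith
  qed
  have D: "d \<le> D"
    using le_pow assms(2) by (simp add: D_def)
  have b: "n + d \<le> 2 ^ b"
    using le_pow[of "n + d"] assms(1) by (simp add: b_def)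
  have d_pow: "d + 1 \<le> 2 ^ d" "d + 2 \<le> 2 ^ d"
    using assms(2) by (induction d rule: nat_induct_at_least) auto
  have "n + d \<le> n * 2 ^ d"
  proof -
    have "n + d \<le> n + n * d"
      using assms(1) by simp
    also have "\<dots> = n * (d + 1)"
      by simp
    also have "\<dots> \<le> n * 2 ^ d"
      using d_pow(1) by (rule mult_left_mono) simp
    finally show ?thesis .
  qed
  then have "real (n + d) \<le> real n * 2 ^ d"
    using of_nat_mono[where 'a = real] by fastforce
  then have "log 2 (real (n + d)) \<le> log 2 (real n * 2 ^ d)"
    using assms(1) by (subst log_le_cancel_iff) auto
  also have "\<dots> = L + d"
    using assms(1) by (simp add: L_def log_mult log_nat_power)
  finally have "log 2 (real (n + d)) \<le> L + d" .
  moreover have "log 2 (real (n + d)) \<ge> 0"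
    using assms(1) by simp
  ultimately have "real b \<le> L + d + 1"
    unfolding b_def by linarith
  also have "\<dots> \<le> L * (d + 2)"
    using mult_right_mono[OF L, of "real d + 1"] by (simp add: algebra_simps)
  finally have b_le: "real b \<le> L * (d + 2)" .
  have R_le: "real (d * b + 1) \<le> L * (real d + 1) ^ 2"
  proof -
    have "real (d * b + 1) \<le> real d * (L * (d + 2)) + L"
      using mult_left_mono[OF b_le, of "real d"] L by simp
    also have "\<dots> = L * (real d + 1) ^ 2"
      by (simp add: power2_eq_square algebra_simps)
    finally show ?thesis .
  qed
  have d_pow': "real d + 1 \<le> 2 ^ d" "real d + 2 \<le> 2 ^ d"
    using d_pow[THEN of_nat_mono[where 'a = real]] by simp_all
  \<comment> \<open>The summand \<open>1\<close> makes the final inequality \<open>d * b < k\<close>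
    strict.\<close>
  have "real (d * b + 1) \<le> L * (2 ^ d) ^ 2"
    by (rule order_trans[OF R_le]) (use d_pow' L in \<open>auto intro!: mult_left_mono power_mono\<close>)
  also have "\<dots> = 4 ^ d * L"
    by (simp add: power2_eq_square flip: power_mult_distrib)
  also have "\<dots> \<le> 4 ^ D * L"
    using D L by (intro mult_right_mono power_increasing) auto
  also have "\<dots> \<le> real k"
    using assms(3) by (simp add: D_def L_def)
  finally have k: "d * b < k"
    by linarith
  obtain P where P: "nof_computes k ({..<n} \<rightarrow>\<^sub>E {..<d}) P (composed k n f g)"
    and cost: "nof_cost k ({..<n} \<rightarrow>\<^sub>E {..<d}) P \<le> (d * b + 1) * ((d + 1) * b)"
    using ex_nof_protocol_symmetric_composed[OF assms(2) _ _ k assms(4)] b assms(2) by auto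
  have "real (nof_cost k ({..<n} \<rightarrow>\<^sub>E {..<d}) P) \<le> real (d * b + 1) * ((real d + 1) * real b)"
    using of_nat_mono[OF cost, where 'a = real] by (simp add: algebra_simps)
  also have "\<dots> \<le> (L * (real d + 1) ^ 2) * ((real d + 1) * (L * (real d + 2)))"
    using R_le b_le L by (intro mult_mono) (auto simp: add.commute)
  \<comment> \<open>Each of the four factors \<open>d + 1\<close>, \<open>d + 1\<close>,
    \<open>d + 1\<close>, \<open>d + 2\<close> is at most \<open>2 ^ d\<close>, which gives
    \<open>16 ^ d\<close>.\<close>
  also have "\<dots> \<le> (L * (2 ^ d) ^ 2) * (2 ^ d * (L * 2 ^ d))"
    using d_pow' L by (intro mult_mono power_mono) auto
  also have "\<dots> = 16 ^ d * L ^ 2"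
  proof -
    have "(16::real) ^ d = (2 ^ d) ^ 4"
      by (simp add: power4_eq_xxxx flip: power_mult_distrib)
    then show ?thesis
      by (simp add: power2_eq_square power4_eq_xxxx)
  qed
  \<comment> \<open>Both exponents are raised to \<open>2 * D\<close> to match the claimed form, as
    \<open>16 ^ (2 * D) = 4 ^ (4 * D)\<close>; this uses \<open>L >= 1\<close>.\<close>
  also have "\<dots> \<le> 16 ^ (2 * D) * L ^ (2 * D)"
    using D L assms(2) by (intro mult_mono power_increasing) auto
  also have "(16::real) ^ (2 * D) = 4 ^ (2 ^ (nat \<lceil>log 2 (real d)\<rceil> + 2))"
    using power_mult[of "4::real" 2 "2 * D"] by (simp add: D_def power_add mult.commute)
  finally show ?thesis
    using P unfolding D_def L_def by blast
qed

end
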